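(* Let $J,K\ge 1$ be integers, $A=\{1,\dots,J\}$, $B=\{1,\dots,K\}$. In the generalized universal distortion setting, $$\limsup_{n\to\infty}\ \inf_{\tilde C_n}\ \sup_{\substack{(p,\rho)\in\mathcal P(A)\times\mathcal D\\ d\in(0,\infty)}}\ \frac{\overline{\mathcal R}_n(\tilde C_n,p,\rho,d)}{\ln n/n}\ \le\ J^2K^2+J-2,$$ where the infimum is over all $n$th order generalized universal distortion codes $\tilde C_n=(\phi_n,f_n,g_n)$ (i.e., codes which meet the input distortion constraint with respect to the input distortion measure).
   Context: $\mathcal P(A)$ is the set of probability distributions on $A$; for $p\in\mathcal P(A)$, $p^n$ is the $n$-fold product distribution on $A^n$. $\mathcal D$ is the set of all distortion measures $\rho:A\times B\to[0,\infty)$ satisfying the standing assumption $\max_{j\in A}\min_{k\in B}\rho(j,k)=0$. The $n$-fold extension is $\rho_n(x^n,y^n)=\frac1n\sum_{i=1}^n\rho(x_i,y_i)$. $\ln$ is the natural logarithm; entropy $H$ is measured in nats. Generalized universal distortion code (order $n$): a triple $\tilde C_n=(\phi_n,f_n,g_n)$ with $\phi_n:A^n\times\mathcal D\times\mathbb R_{>0}\to B_{\phi_n}$, $f_n:B_{\phi_n}\to\mathcal B^*$, $g_n:\mathcal B^*\to B_{\phi_n}$, where $B_{\phi_n}\subset B^n$ is the codebook, $\mathcal B^*$ is a set of binary strings, $(f_n,g_n)$ is a prefix-free (lossless) binary encoder/decoder pair (the strings $f_n(y^n)$ form a prefix-free set and $g_n(f_n(y^n))=y^n$ for all $y^n\in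 B_{\phi_n}$), and $\rho_n(x^n,\phi_n(x^n,\rho,d))\le d$ for all $x^n\in A^n$, $\rho\in\mathcal D$, $d>0$. $l(b)$ denotes the length of a binary string $b$. For $d>0$ and $\rho\in\mathcal D$, $\mathcal Q_{d,\rho}$ is the set of all $d$-quantizers with respect to $\rho$: maps $\phi:A^n\to B^n$ with $\rho_n(x^n,\phi(x^n))\le d$ for all $x^n\in A^n$. For such $\phi$, $\nu_{p^n,\phi}$ is the distribution of $\phi(X^n)$ when $X^n\sim p^n$, i.e. $\nu_{p^n,\phi}(y^n)=\sum_{x^n\in A^n}p^n(x^n)\mathbf 1(\phi(x^n)=y^n)$. Operational rate redundancy: with $X^n\sim p^n$, $$\overline{\mathcal R}_n(\tilde C_n,p,\rho,d)=\frac1n\mathbb E\big[l(f_n(\phi_n(X^n,\rho,d)))\ln 2\big]-\inf_{\phi\in\mathcal Q_{d,\rho}}\frac{H(\nu_{p^n,\phi})}{n}.$$ *)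

theory Defs
  imports "HOL-Probability.Probability" "HOL-Library.Sublist"
begin

text \<open>
  The alphabets \<open>A\<close> and \<open>B\<close> are finite types \<open>'a\<close> and \<open>'b\<close>, so \<open>J = CARD('a)\<close> and \<open>K = CARD('b)\<close>.
  Elements of \<open>A\<^sup>n\<close> and \<open>B\<^sup>n\<close> are lists of length \<open>n\<close>, the set of probability distributions on
  \<open>A\<close> is the type \<open>'a pmf\<close>, and the product distribution \<open>p\<^sup>n\<close> is \<^term>\<open>replicate_pmf n p\<close>.
\<close>

abbreviation words :: "nat \<Rightarrow> 'c list set" where
  "words n \<equiv> {xs. length xs = n}"

definition distortions :: "('a::finite \<Rightarrow> 'b::finite \<Rightarrow> real) set" where
  "distortions = {\<rho>. (\<forall>j k. 0 \<le> \<rho> j k) \<and> (MAX j. MIN k. \<rho> j k) = 0}"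

definition distortion_ext :: "nat \<Rightarrow> ('a \<Rightarrow> 'b \<Rightarrow> real) \<Rightarrow> 'a list \<Rightarrow> 'b list \<Rightarrow> real" where
  "distortion_ext n \<rho> xs ys = (\<Sum>i<n. \<rho> (xs ! i) (ys ! i)) / real n"

definition quantizers ::
    "nat \<Rightarrow> ('a::finite \<Rightarrow> 'b::finite \<Rightarrow> real) \<Rightarrow> real \<Rightarrow> ('a list \<Rightarrow> 'b list) set" where
  "quantizers n \<rho> d =
     {\<phi>. \<phi> \<in> words n \<rightarrow> words n \<and> (\<forall>xs\<in>words n. distortion_ext n \<rho> xs (\<phi> xs) \<le> d)}"

definition output_pmf :: "nat \<Rightarrow> 'a pmf \<Rightarrow> ('a list \<Rightarrow> 'b list) \<Rightarrow> 'b list pmf" where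
  "output_pmf n p \<phi> = map_pmf \<phi> (replicate_pmf n p)"

text \<open>Shannon entropy in nats: the library entropy of the identity random variable, with
  logarithm base \<open>e\<close> and with respect to the counting measure.\<close>

definition entropy_nats :: "'c pmf \<Rightarrow> real" where
  "entropy_nats q =
     prob_space.entropy (measure_pmf q) (exp 1) (count_space UNIV) (\<lambda>y. y)"

lemma entropy_nats_eq_sum:
  fixes q :: "'c::countable pmf"
  assumes "finite (set_pmf q)"
  shows "entropy_nats q = - (\<Sum>y\<in>set_pmf q. pmf q y * ln (pmf q y))"
proof -
  interpret information_space "measure_pmf q" "exp 1"
    by unfold_locales simp
  have "distributed (measure_pmf q) (count_space UNIV) (\<lambda>y. y) (\<lambda>y. ennreal (pmf q y))"
    unfolding distributed_def
    by (auto simp: measure_pmf_eq_density[symmetric] emeasure_distr intro!: measure_eqI)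
  then have "prob_space.entropy (measure_pmf q) (exp 1) (count_space UNIV) (\<lambda>y. y)
      = - (\<integral>y. pmf q y * log (exp 1) (pmf q y) \<partial>count_space UNIV)"
    by (rule entropy_distr) simp
  also have "(\<integral>y. pmf q y * log (exp 1) (pmf q y) \<partial>count_space UNIV)
      = (\<integral>y. pmf q y * ln (pmf q y) \<partial>count_space UNIV)"
    by (simp add: log_def)
  also have "\<dots> = (\<Sum>y\<in>set_pmf q. pmf q y * ln (pmf q y))"
    using assms
    by (subst lebesgue_integral_count_space_finite_support)
       (auto intro!: sum.mono_neutral_left finite_subset[OF _ assms] simp: set_pmf_iff)
  finally show ?thesis
    by (simp add: entropy_nats_def)
qed

text \<open>The codebook \<open>B\<^bsub>\<phi>\<^esub>\<close> and the set of binary strings are the (co)domains of the three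
  component maps, so they are carried along explicitly. Values of the maps outside their domains
  are never used.\<close>

record ('a, 'b) gud_code =
  codebook :: "'b list set"
  strings :: "bool list set"
  quantize :: "'a list \<Rightarrow> ('a \<Rightarrow> 'b \<Rightarrow> real) \<Rightarrow> real \<Rightarrow> 'b list"
  encode :: "'b list \<Rightarrow> bool list"
  decode :: "bool list \<Rightarrow> 'b list"

definition prefix_free :: "bool list set \<Rightarrow> bool" where
  "prefix_free S \<longleftrightarrow> (\<forall>u\<in>S. \<forall>v\<in>S. prefix u v \<longrightarrow> u = v)"

definition gud_codes :: "nat \<Rightarrow> ('a::finite, 'b::finite) gud_code set" where
  "gud_codes n = {C.
     codebook C \<subseteq> words n \<and>
     (\<forall>xs\<in>words n. \<forall>\<rho>\<in>distortions. \<forall>d>0. quantize C xs \<rho> d \<in> codebook C) \<and>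
     encode C \<in> codebook C \<rightarrow> strings C \<and>
     decode C \<in> strings C \<rightarrow> codebook C \<and>
     prefix_free (encode C ` codebook C) \<and>
     (\<forall>ys\<in>codebook C. decode C (encode C ys) = ys) \<and>
     (\<forall>xs\<in>words n. \<forall>\<rho>\<in>distortions. \<forall>d>0. distortion_ext n \<rho> xs (quantize C xs \<rho> d) \<le> d)}"

text \<open>The real-valued infimum below is over a nonempty set (see \<open>quantizers_nonempty\<close>) of
  nonnegative numbers whenever \<open>\<rho> \<in> distortions\<close> and \<open>d > 0\<close>.\<close>

definition rate_redundancy ::
    "nat \<Rightarrow> ('a::finite, 'b::finite) gud_code \<Rightarrow> 'a pmf \<Rightarrow> ('a \<Rightarrow> 'b \<Rightarrow> real) \<Rightarrow> real \<Rightarrow> real" where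
  "rate_redundancy n C p \<rho> d =
     measure_pmf.expectation (replicate_pmf n p)
       (\<lambda>xs. real (length (encode C (quantize C xs \<rho> d))) * ln 2) / real n
     - (INF \<phi>\<in>quantizers n \<rho> d. entropy_nats (output_pmf n p \<phi>) / real n)"

lemma quantizers_nonempty:
  fixes \<rho> :: "'a::finite \<Rightarrow> 'b::finite \<Rightarrow> real"
  assumes \<rho>: "\<rho> \<in> distortions" and d: "d > 0"
  shows "quantizers n \<rho> d \<noteq> {}"
proof -
  have "\<exists>k. \<rho> j k \<le> 0" for j
  proof -
    have "(MIN k. \<rho> j k) \<le> (MAX j. MIN k. \<rho> j k)"
      by (intro Max_ge) auto
    moreover have "(MIN k. \<rho> j k) \<in> range (\<rho> j)"
      by (intro Min_in) auto
    ultimately show ?thesis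
      using \<rho> by (metis (mono_tags, lifting) distortions_def imageE mem_Collect_eq)
  qed
  then obtain g where g: "\<And>j. \<rho> j (g j) \<le> 0"
    by metis
  have "distortion_ext n \<rho> xs (map g xs) \<le> d" if "length xs = n" for xs
  proof -
    have "(\<Sum>i<n. \<rho> (xs ! i) (map g xs ! i)) \<le> 0"
      using that g by (intro sum_nonpos) auto
    then have "distortion_ext n \<rho> xs (map g xs) \<le> 0"
      by (simp add: distortion_ext_def divide_nonpos_nonneg)
    with d show ?thesis
      by linarith
  qed
  then have "map g \<in> quantizers n \<rho> d"
    by (auto simp: quantizers_def)
  then show ?thesis
    by blast
qed

end

theory Submission
  imports Defs "HOL-Real_Asymp.Real_Asymp"
begin

text \<open>
  For a type \<open>t\<close> of source words and a distortion ball \<open>D = {(x, y). \<rho>\<^sub>n(x, y) \<le> d}\<close>, let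
  \<open>\<phi>\<^sub>t\<^sub>,\<^sub>D\<close> be a quantizer respecting \<open>D\<close> whose output has minimal entropy under the uniform
  distribution on the type class of \<open>t\<close>. The code quantizes \<open>x\<close> by \<open>\<phi>\<^sub>t\<^sub>,\<^sub>D\<close> for its type \<open>t\<close> and encodes
  the result with a prefix code matched to the uniform mixture of these output
  distributions over the \<open>M\<close> pairs \<open>(t, D)\<close>. Given the type, a source word is uniformly distributed,
  and conditioning on the type does not increase entropy, so for all \<open>(p, \<rho>, d)\<close> the rate redundancy
  is at most \<open>(ln M + ln 2) / n\<close>.

  It remains to bound \<open>M\<close>. There are at most \<open>(n + 1)\<^bsup>J-1\<^esup>\<close> types. With \<open>m = JK\<close>, a distortion ball is
  determined by the joint types it contains, which are the points of a halfspace among at most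
  \<open>(n + 1)\<^bsup>m-1\<^esup>\<close> points of \<open>\<real>\<^sup>m\<close>. Homogeneous halfspaces in \<open>\<real>\<^sup>m\<close> shatter at most \<open>m\<close> points, so by the
  Sauer-Shelah lemma the number of balls is \<open>O(n\<^bsup>m(m-1)\<^esup>)\<close>, and \<open>m(m - 1) \<le> J\<^sup>2K\<^sup>2 - 1\<close>.
\<close>

section \<open>Shattering\<close>

definition shatters :: "'c set set \<Rightarrow> 'c set \<Rightarrow> bool" where
  "shatters F S \<longleftrightarrow> (\<forall>T\<subseteq>S. \<exists>A\<in>F. A \<inter> S = T)"

lemma shattersE:
  assumes "shatters F S" "T \<subseteq> S"
  obtains A where "A \<in> F" "A \<inter> S = T"
  using assms unfolding shatters_def by meson

text \<open>Pajor's form of the Sauer-Shelah lemma.\<close>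

lemma card_le_card_shattered:
  assumes "finite X" "F \<subseteq> Pow X"
  shows "card F \<le> card {S. S \<subseteq> X \<and> shatters F S}"
  using assms
proof (induction X arbitrary: F rule: finite_induct)
  case empty
  then consider "F = {}" | "F = {{}}"
    by auto
  then show ?case
  proof cases
    case 2
    then have "shatters F {}"
      by (simp add: shatters_def)
    then have "{S. S \<subseteq> {} \<and> shatters F S} = {{}}"
      by blast
    then show ?thesis
      using 2 by simp
  qed simp
next
  case (insert x X)
  \<comment> \<open>\<open>F0\<close> collects the traces on \<open>X\<close>, and \<open>F1\<close>
    those traces that come from two members of \<open>F\<close>, one containing \<open>x\<close> and
    one not. The two sizes therefore add up to that of \<open>F\<close>.\<close>
  define F0 where "F0 = (\<lambda>A. A - {x}) ` F"
  define F1 where "F1 = {A. A \<subseteq> X \<and> A \<in> F \<and> insert x A \<in> F}"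
  have finF: "finite F"
    using insert.prems insert.hyps by (meson finite_Pow_iff finite_insert finite_subset)
  define S0 where "S0 = {S. S \<subseteq> X \<and> shatters F0 S}"
  define S1 where "S1 = {S. S \<subseteq> X \<and> shatters F1 S}"
  have fin: "finite S0" "finite S1"
    using insert.hyps by (auto simp: S0_def S1_def)
  have IH: "card F0 \<le> card S0" "card F1 \<le> card S1"
    unfolding S0_def S1_def using insert.prems by (intro insert.IH; auto simp: F0_def F1_def)+
  have "F = {A\<in>F. x \<notin> A} \<union> {A\<in>F. x \<in> A}"
    by auto
  then have cF: "card F = card {A\<in>F. x \<notin> A} + card {A\<in>F. x \<in> A}"
    by (metis (mono_tags, lifting) Int_emptyI card_Un_disjoint finF finite_Un mem_Collect_eq)
  define G where "G = (\<lambda>A. A - {x}) ` {A\<in>F. x \<in> A}"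
  have "inj_on (\<lambda>A. A - {x}) {A\<in>F. x \<in> A}"
    by (auto intro!: inj_onI)
  then have cG: "card {A\<in>F. x \<in> A} = card G"
    by (simp add: G_def card_image)
  have U: "{A\<in>F. x \<notin> A} \<union> G = F0"
  proof -
    have "(\<lambda>A. A - {x}) ` {A\<in>F. x \<notin> A} = {A\<in>F. x \<notin> A}"
      by (intro equalityI subsetI; auto intro!: rev_image_eqI)
    moreover have "F0 = (\<lambda>A. A - {x}) ` {A\<in>F. x \<notin> A} \<union> G"
      unfolding F0_def G_def image_Un[symmetric] by (rule arg_cong[where f = "image _"]) auto
    ultimately show ?thesis
      by simp
  qed
  have I: "{A\<in>F. x \<notin> A} \<inter> G = F1"
  proof (intro equalityI subsetI)
    fix A assume "A \<in> {A\<in>F. x \<notin> A} \<inter> G"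
    then obtain B where "A \<in> F" "x \<notin> A" "B \<in> F" "x \<in> B" "A = B - {x}"
      by (auto simp: G_def)
    moreover from this have "insert x A = B"
      by auto
    ultimately show "A \<in> F1"
      using insert.prems by (auto simp: F1_def)
  next
    fix A assume "A \<in> F1"
    then have A: "A \<in> F" "insert x A \<in> F" "x \<notin> A"
      using insert.hyps by (auto simp: F1_def)
    then have "A = insert x A - {x}"
      by auto
    with A show "A \<in> {A\<in>F. x \<notin> A} \<inter> G"
      by (auto simp: G_def)
  qed
  have "card F = card F0 + card F1"
    unfolding cF cG U[symmetric] I[symmetric]
    by (rule card_Un_Int) (use finF in \<open>auto simp: G_def\<close>)
  also have "\<dots> \<le> card S0 + card S1"
    using IH by simp
  also have "\<dots> = card S0 + card (insert x ` S1)"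
  proof -
    have "inj_on (insert x) S1"
      using insert.hyps by (intro inj_onI) (auto simp: S1_def)
    then show ?thesis
      by (simp add: card_image)
  qed
  also have "\<dots> = card (S0 \<union> insert x ` S1)"
    using fin insert.hyps by (intro card_Un_disjoint[symmetric]) (auto simp: S0_def)
  \<comment> \<open>A set shattered by \<open>F0\<close> avoids \<open>x\<close> and is shattered by
    \<open>F\<close> as well. A set shattered by \<open>F1\<close> stays shattered by
    \<open>F\<close> after \<open>x\<close> is added, since every trace in \<open>F1\<close> extends
    both with and without \<open>x\<close>.\<close>
  also have "\<dots> \<le> card {S. S \<subseteq> insert x X \<and> shatters F S}"
  proof (intro card_mono subsetI)
    show "finite {S. S \<subseteq> insert x X \<and> shatters F S}"
      using insert.hyps by auto
    fix S assume "S \<in> S0 \<union> insert x ` S1"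
    then consider "S \<in> S0" | R where "R \<in> S1" "S = insert x R"
      by blast
    then show "S \<in> {S. S \<subseteq> insert x X \<and> shatters F S}"
    proof cases
      case 1
      have "shatters F S"
        unfolding shatters_def
      proof (intro allI impI)
        fix T assume T: "T \<subseteq> S"
        have "shatters F0 S"
          using 1 by (simp add: S0_def)
        then obtain A where A: "A \<in> F0" "A \<inter> S = T"
          using T by (rule shattersE)
        then obtain B where "B \<in> F" "A = B - {x}"
          by (auto simp: F0_def)
        moreover have "x \<notin> S"
          using 1 insert.hyps by (auto simp: S0_def)
        ultimately show "\<exists>A\<in>F. A \<inter> S = T"
          using A by (intro bexI[of _ B]) auto
      qed
      then show ?thesis
        using 1 by (auto simp: S0_def)
    next
      case 2
      have "shatters F S"
        unfolding shatters_def
      proof (intro allI impI)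
        fix T assume T: "T \<subseteq> S"
        have xR: "x \<notin> R"
          using 2 insert.hyps by (auto simp: S1_def)
        have "shatters F1 R" "T - {x} \<subseteq> R"
          using T 2 by (auto simp: S1_def)
        then obtain A where A: "A \<in> F1" "A \<inter> R = T - {x}"
          by (rule shattersE)
        then have xA: "A \<in> F" "insert x A \<in> F" "x \<notin> A"
          using insert.hyps by (auto simp: F1_def)
        show "\<exists>A\<in>F. A \<inter> S = T"
        proof (cases "x \<in> T")
          case True
          then show ?thesis
            using A xA xR 2 by (intro bexI[of _ "insert x A"]) auto
        next
          case False
          then show ?thesis
            using A xA xR 2 by (intro bexI[of _ A]) auto
        qed
      qed
      then show ?thesis
        using 2 by (auto simp: S1_def)
    qed
  qed
  finally show ?case .
qed

text \<open>Padding with \<open>None\<close> turns every such subset into a list of length exactly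
  \<open>k\<close>. Counting these lists is coarser than summing binomial coefficients, but has the
  same degree in \<open>card X\<close>.\<close>

lemma card_subsets_card_le:
  assumes "finite X"
  shows "card {S. S \<subseteq> X \<and> card S \<le> k} \<le> (card X + 1) ^ k"
proof -
  let ?L = "{os. set os \<subseteq> insert None (Some ` X) \<and> length os = k}"
  let ?f = "\<lambda>os. {x. Some x \<in> set os}"
  have fin: "finite ?L"
    using assms by (intro finite_lists_length_eq) auto
  have "{S. S \<subseteq> X \<and> card S \<le> k} \<subseteq> ?f ` ?L"
  proof
    fix S assume "S \<in> {S. S \<subseteq> X \<and> card S \<le> k}"
    then have S: "S \<subseteq> X" "card S \<le> k"
      by auto
    then obtain xs where xs: "set xs = S" "length xs = card S"
      by (metis assms finite_distinct_list distinct_card finite_subset)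
    then show "S \<in> ?f ` ?L"
      using S by (intro image_eqI[of _ _ "map Some xs @ replicate (k - card S) None"]) auto
  qed
  then have "card {S. S \<subseteq> X \<and> card S \<le> k} \<le> card ?L"
    using fin by (rule surj_card_le[rotated])
  also have "\<dots> = (card X + 1) ^ k"
    using assms by (subst card_lists_length_eq) (auto simp: card_image)
  finally show ?thesis .
qed

text \<open>Points exceeding the dimension in number are linearly dependent. A halfspace that
  selects exactly the points with nonpositive coefficient makes all terms
  \<open>u x * (w \<bullet> x)\<close> nonnegative and one positive, although they sum to 0. As the
  bounding hyperplanes pass through the origin, the bound is the dimension and not one more.\<close>

lemma card_shattered_by_halfspaces_le:
  fixes S :: "'e::euclidean_space set"
  assumes "finite S" "S \<subseteq> X" and sh: "shatters (range (\<lambda>w. {x\<in>X. w \<bullet> x \<le> 0})) S"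
  shows "card S \<le> DIM('e)"
proof (rule ccontr)
  assume "\<not> ?thesis"
  then have "dependent S"
    using independent_bound by blast
  then obtain u v where u: "v \<in> S" "u v \<noteq> 0" "(\<Sum>x\<in>S. u x *\<^sub>R x) = 0"
    using assms(1) by (auto simp: real_vector.dependent_finite)
  have False if v: "v \<in> S" "u v > 0" and s: "(\<Sum>x\<in>S. u x *\<^sub>R x) = 0" for u v
  proof -
    obtain A where "A \<in> range (\<lambda>w. {x\<in>X. w \<bullet> x \<le> 0})" "A \<inter> S = {x\<in>S. u x \<le> 0}"
      by (rule shattersE[OF sh, of "{x\<in>S. u x \<le> 0}"]) auto
    then obtain w where w: "{x\<in>X. w \<bullet> x \<le> 0} \<inter> S = {x\<in>S. u x \<le> 0}"
      by auto
    have sgn: "w \<bullet> x \<le> 0 \<longleftrightarrow> u x \<le> 0" if "x \<in> S" for x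
      using w that assms(2) by blast
    have "0 < (\<Sum>x\<in>S. u x * (w \<bullet> x))"
    proof (rule sum_pos2[OF assms(1) v(1)])
      show "0 < u v * (w \<bullet> v)"
        using sgn[OF v(1)] v(2) by simp
      show "0 \<le> u x * (w \<bullet> x)" if "x \<in> S" for x
        using sgn[OF that] by (cases "u x \<le> 0") (auto intro: mult_nonpos_nonpos)
    qed
    also have "(\<Sum>x\<in>S. u x * (w \<bullet> x)) = w \<bullet> (\<Sum>x\<in>S. u x *\<^sub>R x)"
      by (simp add: inner_sum_right)
    finally show False
      using s by simp
  qed
  \<comment> \<open>If \<open>v\<close> has a negative coefficient, the negated relation is
    used.\<close>
  from this[of v u] this[of v "\<lambda>x. - u x"] u show False
    by (cases "u v > 0") (auto simp: sum_negf)
qed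

lemma card_halfspace_patterns_le:
  fixes X :: "'e::euclidean_space set"
  assumes "finite X"
  shows "card (range (\<lambda>w. {x\<in>X. w \<bullet> x \<le> 0})) \<le> (card X + 1) ^ DIM('e)"
proof -
  let ?F = "range (\<lambda>w. {x\<in>X. w \<bullet> x \<le> 0})"
  have "card ?F \<le> card {S. S \<subseteq> X \<and> shatters ?F S}"
    using assms by (intro card_le_card_shattered) auto
  also have "\<dots> \<le> card {S. S \<subseteq> X \<and> card S \<le> DIM('e)}"
  proof (intro card_mono subsetI)
    fix S assume "S \<in> {S. S \<subseteq> X \<and> shatters ?F S}"
    then show "S \<in> {S. S \<subseteq> X \<and> card S \<le> DIM('e)}"
      using card_shattered_by_halfspaces_le[of S X] finite_subset[OF _ assms] by auto
  qed (use assms in auto)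
  also have "\<dots> \<le> (card X + 1) ^ DIM('e)"
    using assms by (rule card_subsets_card_le)
  finally show ?thesis .
qed

section \<open>Counting types and distortion balls\<close>

lemma sum_count_UNIV: "(\<Sum>c\<in>UNIV. count M c) = size (M :: 'c::finite multiset)"
  by (simp add: size_multiset_overloaded_eq) (intro sum.mono_neutral_right; auto simp: not_in_iff)

text \<open>The multiplicity of one letter \<open>?z\<close> is forced by the total, so only the
  others are free. This saves one in the exponent for types and for joint types, and the final
  constant depends on both savings.\<close>

lemma multisets_of_size:
  shows finite_multisets_of_size: "finite {M :: 'c::finite multiset. size M = n}"
    and card_multisets_of_size_le:
      "card {M :: 'c::finite multiset. size M = n} \<le> (n + 1) ^ (CARD('c) - 1)"
proof -
  let ?z = "undefined :: 'c"
  let ?f = "\<lambda>M. restrict (count M) (UNIV - {?z})"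
  let ?P = "(UNIV - {?z}) \<rightarrow>\<^sub>E {..n}"
  let ?A = "{M :: 'c multiset. size M = n}"
  have split: "count M ?z + (\<Sum>c\<in>UNIV - {?z}. count M c) = size M" for M :: "'c multiset"
    unfolding sum_count_UNIV[symmetric] by (rule sum.remove[symmetric]) auto
  have inj: "inj_on ?f ?A"
  proof (rule inj_onI)
    fix M N assume MN: "M \<in> ?A" "N \<in> ?A" "?f M = ?f N"
    have eq: "count M c = count N c" if "c \<noteq> ?z" for c
      using fun_cong[OF MN(3), of c] that by simp
    then have "(\<Sum>c\<in>UNIV - {?z}. count M c) = (\<Sum>c\<in>UNIV - {?z}. count N c)"
      by (intro sum.cong) auto
    then have "count M ?z = count N ?z"
      using MN(1,2) split[of M] split[of N] by simp
    with eq show "M = N"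
      by (metis multiset_eqI)
  qed
  have sub: "?f ` ?A \<subseteq> ?P"
  proof (intro image_subsetI PiE_I)
    fix M c assume "M \<in> ?A" "c \<in> UNIV - {?z}"
    then show "?f M c \<in> {..n}"
      using member_le_sum[of c UNIV "count M"] by (simp add: sum_count_UNIV)
  qed simp
  have finP: "finite ?P"
    by (intro finite_PiE) auto
  show "finite ?A"
    using inj_on_finite[OF inj sub finP] .
  show "card ?A \<le> (n + 1) ^ (CARD('c) - 1)"
    using card_inj_on_le[OF inj sub finP] by (simp add: card_PiE card_Diff_singleton)
qed

lemma sum_mset_eq_sum_count:
  fixes f :: "'c::finite \<Rightarrow> real"
  shows "sum_mset (image_mset f M) = (\<Sum>c\<in>UNIV. real (count M c) * f c)"
proof (induction M)
  case (add x M)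
  have "(\<Sum>c\<in>UNIV. real (count (add_mset x M) c) * f c)
      = (\<Sum>c\<in>UNIV. real (count M c) * f c + (if c = x then f c else 0))"
    by (intro sum.cong) (auto simp: algebra_simps)
  then show ?case
    using add by (simp add: sum.distrib)
qed simp

lemma finite_words: "finite (words n :: 'c::finite list set)"
  using finite_lists_length_eq[of "UNIV :: 'c set" n] by simp

text \<open>Taken as a relation on words, a ball is shared by all pairs \<open>(\<rho>, d)\<close>
  that impose the same constraint; this is what makes the family of balls finite.\<close>

definition distortion_ball :: "nat \<Rightarrow> ('a \<Rightarrow> 'b \<Rightarrow> real) \<Rightarrow> real \<Rightarrow> ('a list \<times> 'b list) set" where
  "distortion_ball n \<rho> d = {(xs, ys). xs \<in> words n \<and> ys \<in> words n \<and> distortion_ext n \<rho> xs ys \<le> d}"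

text \<open>The \<open>itself\<close> argument fixes the alphabets in statements about
  cardinalities.\<close>

definition distortion_balls :: "nat \<Rightarrow> ('a::finite \<times> 'b::finite) itself \<Rightarrow> ('a list \<times> 'b list) set set" where
  "distortion_balls n _ = {distortion_ball n \<rho> d |\<rho> d. \<rho> \<in> distortions \<and> d > 0}"

text \<open>Since all joint types have total mass \<open>n\<close>, the constraint \<open>\<rho>\<^sub>n(x, y) \<le> d\<close> is homogeneous in
  the joint type: its normal vector is \<open>\<rho> - d\<close>.\<close>

lemma distortion_ext_le_iff:
  fixes xs :: "'a::finite list" and ys :: "'b::finite list"
  assumes "xs \<in> words n" "ys \<in> words n" "n > 0"
  shows "distortion_ext n \<rho> xs ys \<le> d \<longleftrightarrow>
    (\<chi> c. case_prod \<rho> c - d) \<bullet> (\<chi> c. real (count (mset (zip xs ys)) c)) \<le> 0"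
proof -
  let ?M = "mset (zip xs ys)"
  have "(\<Sum>i<n. \<rho> (xs ! i) (ys ! i)) = sum_list (map (case_prod \<rho>) (zip xs ys))"
    using assms by (simp add: sum_list_sum_nth atLeast0LessThan)
  also have "\<dots> = sum_mset (image_mset (case_prod \<rho>) ?M)"
    by (metis mset_map sum_mset_sum_list)
  finally have 1: "(\<Sum>i<n. \<rho> (xs ! i) (ys ! i)) = (\<Sum>c\<in>UNIV. real (count ?M c) * case_prod \<rho> c)"
    by (simp add: sum_mset_eq_sum_count)
  have "real n = (\<Sum>c\<in>UNIV. real (count ?M c))"
    using assms sum_count_UNIV[of ?M] by (simp flip: of_nat_sum)
  then have "real n * d = (\<Sum>c\<in>UNIV. real (count ?M c) * d)"
    by (simp add: sum_distrib_right)
  with 1 have "(\<chi> c. case_prod \<rho> c - d) \<bullet> (\<chi> c. real (count ?M c))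
      = (\<Sum>i<n. \<rho> (xs ! i) (ys ! i)) - real n * d"
    by (simp add: inner_vec_def sum_subtractf algebra_simps)
  moreover have "distortion_ext n \<rho> xs ys \<le> d \<longleftrightarrow> (\<Sum>i<n. \<rho> (xs ! i) (ys ! i)) \<le> real n * d"
    using assms(3) by (simp add: distortion_ext_def field_simps)
  ultimately show ?thesis
    by simp
qed

text \<open>Membership of \<open>(xs, ys)\<close> depends only on whether the joint type lies in a
  halfspace, so every ball is the preimage under \<open>g\<close> of a halfspace pattern on the set
  \<open>X\<close> of joint types. The inner exponent counts joint types; the outer one is the
  dimension of the space.\<close>

lemma distortion_balls_bound:
  assumes "n > 0"
  shows finite_distortion_balls: "finite (distortion_balls n TYPE('a::finite \<times> 'b::finite))"
    and card_distortion_balls_le: "card (distortion_balls n TYPE('a \<times> 'b))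
      \<le> ((n + 1) ^ (CARD('a) * CARD('b) - 1) + 1) ^ (CARD('a) * CARD('b))"
proof -
  define v :: "('a \<times> 'b) multiset \<Rightarrow> real ^ ('a \<times> 'b)" where "v = (\<lambda>M. \<chi> c. real (count M c))"
  define X where "X = v ` {M. size M = n}"
  have finX: "finite X"
    by (simp add: X_def finite_multisets_of_size)
  have cX: "card X \<le> (n + 1) ^ (CARD('a) * CARD('b) - 1)"
    using card_image_le[OF finite_multisets_of_size, of v n] card_multisets_of_size_le[of n, where 'c="'a \<times> 'b"]
    by (simp add: X_def)
  let ?H = "range (\<lambda>w. {x\<in>X. w \<bullet> x \<le> 0})"
  define g :: "(real ^ ('a \<times> 'b)) set \<Rightarrow> ('a list \<times> 'b list) set" where
    "g P = {(xs, ys). xs \<in> words n \<and> ys \<in> words n \<and> v (mset (zip xs ys)) \<in> P}" for P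
  have sub: "distortion_balls n TYPE('a \<times> 'b) \<subseteq> g ` ?H"
  proof
    fix D assume "D \<in> distortion_balls n TYPE('a \<times> 'b)"
    then obtain \<rho> :: "'a \<Rightarrow> 'b \<Rightarrow> real" and d where D: "D = distortion_ball n \<rho> d"
      by (auto simp: distortion_balls_def)
    have "D = g {x\<in>X. (\<chi> c. case_prod \<rho> c - d) \<bullet> x \<le> 0}"
      unfolding D distortion_ball_def g_def
      using assms by (auto simp: distortion_ext_le_iff v_def X_def)
    then show "D \<in> g ` ?H"
      by auto
  qed
  have finH: "finite ?H"
    by (rule finite_subset[of _ "Pow X"]) (use finX in auto)
  show "finite (distortion_balls n TYPE('a \<times> 'b))"
    using finite_subset[OF sub] finH by blast
  have "card (distortion_balls n TYPE('a \<times> 'b)) \<le> card ?H"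
    using finH sub by (rule surj_card_le)
  also have "\<dots> \<le> (card X + 1) ^ (CARD('a) * CARD('b))"
    using card_halfspace_patterns_le[OF finX] by simp
  also have "\<dots> \<le> ((n + 1) ^ (CARD('a) * CARD('b) - 1) + 1) ^ (CARD('a) * CARD('b))"
    using cX by (intro power_mono) auto
  finally show "card (distortion_balls n TYPE('a \<times> 'b)) \<le> \<dots>" .
qed

section \<open>Prefix codes\<close>

text \<open>Code words are chosen greedily by increasing length: the words already chosen block
  fewer than \<open>2\<^bsup>l x\<^esup>\<close> words of length \<open>l x\<close>.\<close>

lemma kraft_converse:
  fixes l :: "'y \<Rightarrow> nat"
  assumes "finite S" "(\<Sum>y\<in>S. (1 / 2) ^ l y :: real) \<le> 1"
  shows "\<exists>e. inj_on e S \<and> prefix_free (e ` S) \<and> (\<forall>y\<in>S. length (e y) = l y)"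
  using assms
proof (induction S rule: finite_ranking_induct[where f = l])
  case empty
  then show ?case
    by (auto simp: prefix_free_def)
next
  case (insert x S)
  show ?case
  proof (cases "x \<in> S")
    case True
    then show ?thesis
      using insert by (simp add: insert_absorb)
  next
    case False
    then have s: "(\<Sum>y\<in>S. (1 / 2) ^ l y :: real) + (1 / 2) ^ l x \<le> 1"
      using insert by (simp add: algebra_simps)
    then have "(\<Sum>y\<in>S. (1 / 2) ^ l y :: real) \<le> 1"
      by (smt (verit) zero_le_power zero_le_divide_1_iff)
    then obtain e where e: "inj_on e S" "prefix_free (e ` S)" "\<And>y. y \<in> S \<Longrightarrow> length (e y) = l y"
      using insert.IH by blast
    \<comment> \<open>\<open>bad\<close> is the set of words of length \<open>l x\<close> that
      extend an earlier code word. The induction adds elements in order of increasing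
      \<open>l\<close>, so \<open>l y \<le> l x\<close> and the natural subtraction is
      exact.\<close>
    define bad where "bad = (\<Union>y\<in>S. (@) (e y) ` words (l x - l y))"
    have "card bad \<le> (\<Sum>y\<in>S. card ((@) (e y) ` (words (l x - l y) :: bool list set)))"
      unfolding bad_def by (rule card_UN_le[OF insert(1)])
    also have "\<dots> \<le> (\<Sum>y\<in>S. 2 ^ (l x - l y))"
    proof (rule sum_mono)
      fix y
      have "card (words (l x - l y) :: bool list set) = 2 ^ (l x - l y)"
        using card_lists_length_eq[of "UNIV :: bool set" "l x - l y"] by simp
      then show "card ((@) (e y) ` (words (l x - l y) :: bool list set)) \<le> 2 ^ (l x - l y)"
        by (metis card_image_le finite_words)
    qed
    finally have "real (card bad) \<le> real (\<Sum>y\<in>S. 2 ^ (l x - l y))"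
      by (simp only: of_nat_le_iff)
    also have "\<dots> = (\<Sum>y\<in>S. 2 ^ (l x - l y))"
      by simp
    also have "\<dots> = (\<Sum>y\<in>S. 2 ^ l x * (1 / 2) ^ l y)"
      using insert(2) by (intro sum.cong) (auto simp: power_diff power_divide)
    also have "\<dots> = 2 ^ l x * (\<Sum>y\<in>S. (1 / 2) ^ l y)"
      by (simp add: sum_distrib_left)
    \<comment> \<open>The summand of \<open>x\<close> itself leaves room: at most
      \<open>2 ^ l x - 1\<close> words are blocked.\<close>
    also have "\<dots> \<le> 2 ^ l x * (1 - (1 / 2) ^ l x)"
      using s by (intro mult_left_mono) auto
    also have "\<dots> < real (card (words (l x) :: bool list set))"
      using card_lists_length_eq[of "UNIV :: bool set" "l x"]
      by (simp add: algebra_simps flip: power_mult_distrib)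
    finally have "card bad < card (words (l x) :: bool list set)"
      by simp
    then have "\<not> words (l x) \<subseteq> bad"
      using card_mono[of bad "words (l x)"] insert(1) finite_words by (force simp: bad_def)
    then obtain w where w: "length w = l x" "w \<notin> bad"
      by auto
    have np: "\<not> prefix (e y) w" if "y \<in> S" for y
    proof
      assume "prefix (e y) w"
      then obtain z where "w = e y @ z"
        by (auto simp: prefix_def)
      with w that e(3)[OF that] show False
        by (auto simp: bad_def)
    qed
    have np': "\<not> prefix w (e y)" if "y \<in> S" for y
    proof
      assume p: "prefix w (e y)"
      have "length (e y) \<le> length w"
        using insert(2)[OF that] w e(3)[OF that] by simp
      with p have "w = e y"
        by (auto simp: prefix_def)
      with np[OF that] show False
        by simp
    qed
    let ?e = "e(x := w)"
    have S: "?e y = e y" if "y \<in> S" for y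
      using that False by auto
    have im: "?e ` insert x S = insert w (e ` S)"
      using False by auto
    have "inj_on ?e (insert x S)"
      using e(1) np False by (auto simp: inj_on_def)
    moreover have "prefix_free (?e ` insert x S)"
      unfolding im using e(2) np np' by (auto simp: prefix_free_def)
    moreover have "\<forall>y\<in>insert x S. length (?e y) = l y"
      using e(3) w S by simp
    ultimately show ?thesis
      by blast
  qed
qed

text \<open>This is the Shannon code of the uniform mixture \<open>Q\<close>. Since
  \<open>q i y / card I \<le> Q y\<close>, coding for \<open>Q\<close> instead of \<open>q i\<close>
  costs at most \<open>ln (card I)\<close>, and rounding lengths up costs at most
  \<open>ln 2\<close>. Only \<open>S\<close>, where \<open>Q\<close> is positive, receives code
  words.\<close>

lemma mixture_code:
  fixes q :: "'i \<Rightarrow> 'y \<Rightarrow> real"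
  assumes "finite I" "finite Y"
    and q: "\<And>i y. q i y \<ge> 0" "\<And>i. i \<in> I \<Longrightarrow> (\<Sum>y\<in>Y. q i y) \<le> 1"
  defines "S \<equiv> {y\<in>Y. \<exists>i\<in>I. q i y > 0}"
  obtains e where "inj_on e S" "prefix_free (e ` S)"
    "\<And>i y. i \<in> I \<Longrightarrow> y \<in> Y \<Longrightarrow> q i y > 0 \<Longrightarrow>
       real (length (e y)) * ln 2 \<le> ln (card I) + ln 2 - ln (q i y)"
proof -
  define Q where "Q y = (\<Sum>i\<in>I. q i y) / card I" for y
  have finS: "finite S"
    using assms by (simp add: S_def)
  have Qlow: "q i y / card I \<le> Q y" if "i \<in> I" for i y
    unfolding Q_def using assms that by (intro divide_right_mono member_le_sum) auto
  have Qpos: "Q y > 0" if "y \<in> S" for y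
  proof -
    from that obtain i where i: "i \<in> I" "q i y > 0"
      by (auto simp: S_def)
    then have "card I > 0"
      using assms(1) card_gt_0_iff by blast
    then have "0 < q i y / card I"
      using i by simp
    with Qlow[OF i(1), of y] show ?thesis
      by linarith
  qed
  have "(\<Sum>y\<in>S. Q y) \<le> (\<Sum>y\<in>Y. Q y)"
    using assms by (intro sum_mono2) (auto simp: Q_def S_def intro!: divide_nonneg_nonneg sum_nonneg)
  also have "\<dots> = (\<Sum>i\<in>I. \<Sum>y\<in>Y. q i y) / card I"
    by (simp add: Q_def sum_divide_distrib sum.swap[of _ Y I])
  also have "\<dots> \<le> (\<Sum>i\<in>I. 1) / card I"
    using q(2) by (intro divide_right_mono sum_mono) auto
  \<comment> \<open>For empty \<open>I\<close> the quotient is 0.\<close>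
  also have "\<dots> \<le> 1"
    by simp
  finally have sumQ: "(\<Sum>y\<in>S. Q y) \<le> 1" .
  have Qle: "Q y \<le> 1" if "y \<in> S" for y
    using member_le_sum[of y S Q] that sumQ finS Qpos by (smt (verit) DiffD1)
  \<comment> \<open>Shannon lengths. By \<open>Qle\<close> the logarithm is nonpositive, so
    \<open>nat\<close> truncates nothing.\<close>
  define l where "l y = nat \<lceil>- log 2 (Q y)\<rceil>" for y
  have l: "- log 2 (Q y) \<le> l y" "l y \<le> - log 2 (Q y) + 1" if "y \<in> S" for y
  proof -
    have "log 2 (Q y) \<le> 0"
      using Qpos[OF that] Qle[OF that] by simp
    then have "real (l y) = \<lceil>- log 2 (Q y)\<rceil>"
      by (simp add: l_def)
    then show "- log 2 (Q y) \<le> l y" "l y \<le> - log 2 (Q y) + 1"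
      by linarith+
  qed
  have "(\<Sum>y\<in>S. (1 / 2) ^ l y) \<le> (\<Sum>y\<in>S. Q y)"
  proof (rule sum_mono)
    fix y assume y: "y \<in> S"
    have "(1 / 2 :: real) ^ l y = 2 powr (- real (l y))"
      by (simp only: powr_minus powr_realpow zero_less_numeral power_one_over power_inverse inverse_eq_divide)
    also have "\<dots> \<le> 2 powr (log 2 (Q y))"
      using l(1)[OF y] by (intro powr_mono) auto
    also have "\<dots> = Q y"
      using Qpos[OF y] by simp
    finally show "(1 / 2) ^ l y \<le> Q y" .
  qed
  with sumQ have "(\<Sum>y\<in>S. (1 / 2) ^ l y :: real) \<le> 1"
    by linarith
  from kraft_converse[OF finS this] obtain e where
    e: "inj_on e S" "prefix_free (e ` S)" "\<And>y. y \<in> S \<Longrightarrow> length (e y) = l y"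
    by blast
  show thesis
  proof (rule that[OF e(1,2)])
    fix i y assume i: "i \<in> I" and y: "y \<in> Y" and qp: "q i y > 0"
    then have yS: "y \<in> S"
      by (auto simp: S_def)
    have cI: "card I > 0"
      using i assms(1) card_gt_0_iff by blast
    have "real (length (e y)) * ln 2 \<le> (- log 2 (Q y) + 1) * ln 2"
      using l(2)[OF yS] e(3)[OF yS] by (intro mult_right_mono) auto
    also have "\<dots> = ln 2 - ln (Q y)"
      by (simp add: log_def algebra_simps)
    also have "\<dots> \<le> ln 2 - ln (q i y / card I)"
      using Qlow[OF i, of y] qp cI Qpos[OF yS] by simp
    also have "\<dots> = ln (card I) + ln 2 - ln (q i y)"
      using qp cI by (simp add: ln_div)
    finally show "real (length (e y)) * ln 2 \<le> ln (card I) + ln 2 - ln (q i y)" .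
  qed
qed

section \<open>Output entropy and its restriction to type classes\<close>

text \<open>The law of the output given type \<open>t\<close> when the source word is uniform on
  \<open>W\<close>. For an empty type class, division by zero makes it 0.\<close>

definition cond_output :: "'x set \<Rightarrow> ('x \<Rightarrow> 't) \<Rightarrow> ('x \<Rightarrow> 'y) \<Rightarrow> 't \<Rightarrow> 'y \<Rightarrow> real" where
  "cond_output W \<tau> \<phi> t y = real (card {x\<in>W. \<tau> x = t \<and> \<phi> x = y}) / real (card {x\<in>W. \<tau> x = t})"

lemma cond_output_nonneg: "cond_output W \<tau> \<phi> t y \<ge> 0"
  by (simp add: cond_output_def)

lemma cond_output_pos:
  assumes "finite W" "x \<in> W"
  shows "cond_output W \<tau> \<phi> (\<tau> x) (\<phi> x) > 0"
proof -
  have "card {x'\<in>W. \<tau> x' = \<tau> x \<and> \<phi> x' = \<phi> x} > 0" "card {x'\<in>W. \<tau> x' = \<tau> x} > 0"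
    using assms by (auto simp: card_gt_0_iff)
  then show ?thesis
    by (simp add: cond_output_def)
qed

lemma cond_output_cong:
  assumes "\<And>x. x \<in> W \<Longrightarrow> \<phi> x = \<psi> x"
  shows "cond_output W \<tau> \<phi> = cond_output W \<tau> \<psi>"
proof -
  have "{x\<in>W. \<tau> x = t \<and> \<phi> x = y} = {x\<in>W. \<tau> x = t \<and> \<psi> x = y}" for t y
    using assms by auto
  then show ?thesis
    by (simp add: cond_output_def fun_eq_iff)
qed

lemma sum_cond_output_le:
  assumes "finite W" "finite Y"
  shows "(\<Sum>y\<in>Y. cond_output W \<tau> \<phi> t y) \<le> 1"
proof -
  have "(\<Sum>y\<in>Y. card {x\<in>W. \<tau> x = t \<and> \<phi> x = y}) = card (\<Union>y\<in>Y. {x\<in>W. \<tau> x = t \<and> \<phi> x = y})"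
    using assms by (intro card_UN_disjoint[symmetric]) auto
  also have "\<dots> \<le> card {x\<in>W. \<tau> x = t}"
    using assms by (intro card_mono) auto
  finally have "real (\<Sum>y\<in>Y. card {x\<in>W. \<tau> x = t \<and> \<phi> x = y}) \<le> real (card {x\<in>W. \<tau> x = t})"
    by (simp only: of_nat_le_iff)
  then have "(\<Sum>y\<in>Y. cond_output W \<tau> \<phi> t y)
      \<le> real (card {x\<in>W. \<tau> x = t}) / real (card {x\<in>W. \<tau> x = t})"
    unfolding cond_output_def sum_divide_distrib[symmetric]
    by (intro divide_right_mono) simp_all
  also have "\<dots> \<le> 1"
    by simp
  finally show ?thesis .
qed

text \<open>Conditioning on the type does not increase the entropy of the output. This is Gibbs'
  inequality, applied to the joint law of type and output and the product of its marginals.\<close>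

lemma conditional_entropy_le:
  fixes P :: "'x \<Rightarrow> real"
  assumes W: "finite W" and P: "\<And>x. P x \<ge> 0" "(\<Sum>x\<in>W. P x) = 1"
    and const: "\<And>x x'. x \<in> W \<Longrightarrow> x' \<in> W \<Longrightarrow> \<tau> x = \<tau> x' \<Longrightarrow> P x = P x'"
  shows "(\<Sum>x\<in>W. P x * - ln (cond_output W \<tau> \<phi> (\<tau> x) (\<phi> x)))
    \<le> (\<Sum>x\<in>W. P x * - ln (\<Sum>x' | x' \<in> W \<and> \<phi> x' = \<phi> x. P x'))"
proof -
  define \<nu> where "\<nu> y = (\<Sum>x | x \<in> W \<and> \<phi> x = y. P x)" for y
  define a where "a t = (\<Sum>x | x \<in> W \<and> \<tau> x = t. P x)" for t
  define F where "F = cond_output W \<tau> \<phi>"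
  define N where "N t y = real (card {x\<in>W. \<tau> x = t \<and> \<phi> x = y})" for t y
  define T where "T t = real (card {x\<in>W. \<tau> x = t})" for t
  have F: "F t y = N t y / T t" for t y
    by (simp add: F_def N_def T_def cond_output_def)
  have Fpos: "F (\<tau> x) (\<phi> x) > 0" if "x \<in> W" for x
    using cond_output_pos[OF W that] by (simp add: F_def)
  have aT: "a (\<tau> x) = P x * T (\<tau> x)" if "x \<in> W" for x
  proof -
    have "a (\<tau> x) = (\<Sum>x' | x' \<in> W \<and> \<tau> x' = \<tau> x. P x)"
      unfolding a_def using const[OF _ that] by (intro sum.cong) auto
    then show ?thesis
      by (simp add: T_def)
  qed
  have nn: "\<nu> y \<ge> 0" "a t \<ge> 0" for y t
    using P by (auto simp: \<nu>_def a_def sum_nonneg)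
  have \<nu>ge: "P x \<le> \<nu> (\<phi> x)" if "x \<in> W" for x
    unfolding \<nu>_def using W P that by (intro member_le_sum) auto
  let ?g = "\<lambda>x. (\<tau> x, \<phi> x)"
  \<comment> \<open>On \<open>W\<close> the quotient of \<open>P\<close> by \<open>F\<close> equals
    \<open>a / N\<close>, because \<open>P\<close> is constant on type classes. Each pair of type
    and output then contributes \<open>N\<close> equal terms, in total \<open>a * \<nu>\<close>, and
    these products of marginals sum to at most 1.\<close>
  have "(\<Sum>x\<in>W. P x * (\<nu> (\<phi> x) / F (\<tau> x) (\<phi> x)))
      = (\<Sum>x\<in>W. a (\<tau> x) * \<nu> (\<phi> x) / N (\<tau> x) (\<phi> x))"
    by (intro sum.cong) (auto simp: aT F)
  also have "\<dots> = (\<Sum>z\<in>?g ` W. \<Sum>x | x \<in> W \<and> ?g x = z. a (\<tau> x) * \<nu> (\<phi> x) / N (\<tau> x) (\<phi> x))"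
    by (rule sum.image_gen[OF W])
  also have "\<dots> = (\<Sum>z\<in>?g ` W. a (fst z) * \<nu> (snd z))"
  proof (rule sum.cong[OF refl])
    fix z assume "z \<in> ?g ` W"
    then obtain x0 where x0: "x0 \<in> W" "z = (\<tau> x0, \<phi> x0)"
      by auto
    then have "N (fst z) (snd z) \<noteq> 0"
      using Fpos[OF x0(1)] by (auto simp: F)
    moreover have "(\<Sum>x | x \<in> W \<and> ?g x = z. a (\<tau> x) * \<nu> (\<phi> x) / N (\<tau> x) (\<phi> x))
        = (\<Sum>x | x \<in> W \<and> \<tau> x = fst z \<and> \<phi> x = snd z. a (fst z) * \<nu> (snd z) / N (fst z) (snd z))"
      by (intro sum.cong) (auto simp: x0)
    ultimately show "(\<Sum>x | x \<in> W \<and> ?g x = z. a (\<tau> x) * \<nu> (\<phi> x) / N (\<tau> x) (\<phi> x))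
        = a (fst z) * \<nu> (snd z)"
      by (simp add: N_def)
  qed
  also have "\<dots> \<le> (\<Sum>z\<in>\<tau> ` W \<times> \<phi> ` W. a (fst z) * \<nu> (snd z))"
    using W nn by (intro sum_mono2) auto
  also have "\<dots> = (\<Sum>t\<in>\<tau> ` W. a t) * (\<Sum>y\<in>\<phi> ` W. \<nu> y)"
    by (simp add: sum_product sum.cartesian_product case_prod_beta)
  also have "(\<Sum>t\<in>\<tau> ` W. a t) = 1"
    unfolding a_def P(2)[symmetric] by (rule sum.image_gen[OF W, symmetric])
  also have "(\<Sum>y\<in>\<phi> ` W. \<nu> y) = 1"
    unfolding \<nu>_def P(2)[symmetric] by (rule sum.image_gen[OF W, symmetric])
  finally have le1: "(\<Sum>x\<in>W. P x * (\<nu> (\<phi> x) / F (\<tau> x) (\<phi> x))) \<le> 1"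
    by simp
  have "(\<Sum>x\<in>W. P x * - ln (F (\<tau> x) (\<phi> x))) - (\<Sum>x\<in>W. P x * - ln (\<nu> (\<phi> x)))
      = (\<Sum>x\<in>W. P x * (ln (\<nu> (\<phi> x)) - ln (F (\<tau> x) (\<phi> x))))"
    unfolding sum_subtractf[symmetric] by (intro sum.cong) (auto simp: algebra_simps)
  also have "\<dots> \<le> (\<Sum>x\<in>W. P x * (\<nu> (\<phi> x) / F (\<tau> x) (\<phi> x) - 1))"
  proof (rule sum_mono)
    fix x assume x: "x \<in> W"
    show "P x * (ln (\<nu> (\<phi> x)) - ln (F (\<tau> x) (\<phi> x))) \<le> P x * (\<nu> (\<phi> x) / F (\<tau> x) (\<phi> x) - 1)"
    \<comment> \<open>If \<open>P x = 0\<close>, the output probability may vanish and the logarithm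
      of the quotient need not split; both sides are then 0.\<close>
    proof (cases "P x = 0")
      case False
      then have "\<nu> (\<phi> x) > 0"
        using P(1)[of x] \<nu>ge[OF x] by linarith
      then have "ln (\<nu> (\<phi> x)) - ln (F (\<tau> x) (\<phi> x)) \<le> \<nu> (\<phi> x) / F (\<tau> x) (\<phi> x) - 1"
        using Fpos[OF x] ln_le_minus_one[of "\<nu> (\<phi> x) / F (\<tau> x) (\<phi> x)"] by (simp add: ln_div)
      then show ?thesis
        using P(1) by (rule mult_left_mono)
    qed simp
  qed
  also have "\<dots> = (\<Sum>x\<in>W. P x * (\<nu> (\<phi> x) / F (\<tau> x) (\<phi> x))) - 1"
    by (simp add: right_diff_distrib sum_subtractf P(2))
  also have "\<dots> \<le> 0"
    using le1 by simp
  finally show ?thesis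
    by (simp add: F_def \<nu>_def)
qed

text \<open>Spreading the term of each output over the source words mapped to it writes the entropy
  as an expectation over source words, the form used in \<open>conditional_entropy_le\<close> and
  for the expected code length.\<close>

lemma entropy_nats_map_pmf:
  fixes r :: "'x pmf" and \<phi> :: "'x \<Rightarrow> 'y::countable"
  assumes W: "finite W" "set_pmf r \<subseteq> W"
  shows "entropy_nats (map_pmf \<phi> r)
    = (\<Sum>x\<in>W. pmf r x * - ln (\<Sum>x' | x' \<in> W \<and> \<phi> x' = \<phi> x. pmf r x'))"
proof -
  define \<nu> where "\<nu> y = (\<Sum>x | x \<in> W \<and> \<phi> x = y. pmf r x)" for y
  have \<nu>: "pmf (map_pmf \<phi> r) y = \<nu> y" for y
  proof -
    have "pmf (map_pmf \<phi> r) y = measure (measure_pmf r) (\<phi> -` {y})"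
      by (rule pmf_map)
    also have "\<dots> = measure (measure_pmf r) {x\<in>W. \<phi> x = y}"
      using W(2) by (intro measure_pmf.finite_measure_eq_AE) (auto simp: AE_measure_pmf_iff)
    also have "\<dots> = \<nu> y"
      using W(1) by (simp add: measure_measure_pmf_finite \<nu>_def)
    finally show ?thesis .
  qed
  have sub: "set_pmf (map_pmf \<phi> r) \<subseteq> \<phi> ` W"
    using W(2) by auto
  have "entropy_nats (map_pmf \<phi> r) = - (\<Sum>y\<in>set_pmf (map_pmf \<phi> r). \<nu> y * ln (\<nu> y))"
    using finite_subset[OF sub] W(1) by (simp only: entropy_nats_eq_sum \<nu> finite_imageI)
  also have "(\<Sum>y\<in>set_pmf (map_pmf \<phi> r). \<nu> y * ln (\<nu> y)) = (\<Sum>y\<in>\<phi> ` W. \<nu> y * ln (\<nu> y))"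
    using W(1) sub by (intro sum.mono_neutral_left) (auto simp: \<nu>[symmetric] set_pmf_iff simp del: set_map_pmf)
  also have "\<dots> = (\<Sum>y\<in>\<phi> ` W. \<Sum>x | x \<in> W \<and> \<phi> x = y. pmf r x * ln (\<nu> (\<phi> x)))"
  proof (rule sum.cong[OF refl])
    fix y
    have "(\<Sum>x | x \<in> W \<and> \<phi> x = y. pmf r x * ln (\<nu> (\<phi> x))) = (\<Sum>x | x \<in> W \<and> \<phi> x = y. pmf r x * ln (\<nu> y))"
      by (intro sum.cong) auto
    then show "\<nu> y * ln (\<nu> y) = (\<Sum>x | x \<in> W \<and> \<phi> x = y. pmf r x * ln (\<nu> (\<phi> x)))"
      by (simp add: \<nu>_def sum_distrib_right)
  qed
  also have "\<dots> = (\<Sum>x\<in>W. pmf r x * ln (\<nu> (\<phi> x)))"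
    by (rule sum.image_gen[OF W(1), symmetric])
  finally show ?thesis
    by (simp add: \<nu>_def sum_negf)
qed

text \<open>The product over the multiset makes it visible that the probability of a word depends
  only on its type.\<close>

lemma pmf_replicate_pmf:
  "pmf (replicate_pmf n p) xs = (if length xs = n then \<Prod>x\<in>#mset xs. pmf p x else 0)"
proof (induction n arbitrary: xs)
  case 0
  show ?case
    by (auto simp: pmf_return)
next
  case (Suc n)
  have eq: "replicate_pmf (Suc n) p = map_pmf (case_prod (#)) (pair_pmf p (replicate_pmf n p))"
    by (simp add: pair_pmf_def map_bind_pmf)
  show ?case
  proof (cases xs)
    case Nil
    then show ?thesis
      using set_replicate_pmf[of "Suc n" p] by (auto simp: pmf_eq_0_set_pmf simp del: replicate_pmf.simps)
  next
    case (Cons x zs)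
    have "inj (case_prod (#) :: 'a \<times> 'a list \<Rightarrow> 'a list)"
      by (auto intro!: injI)
    from pmf_map_inj'[OF this, of "pair_pmf p (replicate_pmf n p)" "(x, zs)"]
    show ?thesis
      unfolding eq Cons by (simp add: pmf_pair Suc)
  qed
qed

section \<open>The universal code\<close>

definition ball_quantizers :: "nat \<Rightarrow> ('a list \<times> 'b list) set \<Rightarrow> ('a list \<Rightarrow> 'b list) set" where
  "ball_quantizers n D = {\<phi>. \<phi> \<in> words n \<rightarrow> words n \<and> (\<forall>xs\<in>words n. (xs, \<phi> xs) \<in> D)}"

lemma ball_quantizers_distortion_ball:
  "ball_quantizers n (distortion_ball n \<rho> d) = quantizers n \<rho> d"
  by (auto simp: ball_quantizers_def distortion_ball_def quantizers_def)

text \<open>Up to the factor \<open>1 / |T\<^sub>t|\<close>, the entropy of the output when the source word is uniform on the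
  type class \<open>T\<^sub>t\<close>.\<close>

definition type_cost :: "nat \<Rightarrow> ('a list \<Rightarrow> 'b list) \<Rightarrow> 'a multiset \<Rightarrow> real" where
  "type_cost n \<phi> t =
     (\<Sum>xs | xs \<in> words n \<and> mset xs = t. - ln (cond_output (words n) mset \<phi> t (\<phi> xs)))"

text \<open>The cost sees a quantizer only through its values on \<open>words n\<close>. Up to
  restriction there are finitely many quantizers, so the minimum is attained.\<close>

lemma ex_optimal_quantizer:
  fixes D :: "('a::finite list \<times> 'b::finite list) set"
  assumes "ball_quantizers n D \<noteq> {}"
  shows "\<exists>\<phi>\<in>ball_quantizers n D. \<forall>\<psi>\<in>ball_quantizers n D. type_cost n \<phi> t \<le> type_cost n \<psi> t"
proof -
  let ?W = "words n :: 'a list set"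
  let ?S = "(\<lambda>\<phi>. restrict \<phi> ?W) ` ball_quantizers n D"
  have fin: "finite ?S"
  proof (rule finite_subset)
    show "?S \<subseteq> ?W \<rightarrow>\<^sub>E words n"
      unfolding ball_quantizers_def by (intro image_subsetI restrict_PiE_iff[THEN iffD2]) blast
  qed (intro finite_PiE finite_words)
  have cost: "type_cost n (restrict \<phi> ?W) t = type_cost n \<phi> t" for \<phi> :: "'a list \<Rightarrow> 'b list"
    unfolding type_cost_def using cond_output_cong[of ?W "restrict \<phi> ?W" \<phi> mset]
    by (intro sum.cong) auto
  let ?m = "arg_min_on (\<lambda>\<phi>. type_cost n \<phi> t) ?S"
  have ne: "?S \<noteq> {}"
    using assms by simp
  obtain \<phi> where \<phi>: "\<phi> \<in> ball_quantizers n D" "?m = restrict \<phi> ?W"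
    using arg_min_if_finite(1)[OF fin ne] by (rule imageE)
  have "type_cost n \<phi> t \<le> type_cost n \<psi> t" if "\<psi> \<in> ball_quantizers n D" for \<psi>
    using arg_min_least[OF fin ne imageI[OF that], of "\<lambda>\<phi>. type_cost n \<phi> t"]
    unfolding \<phi>(2) cost .
  with \<phi>(1) show ?thesis
    by blast
qed

lemma ex_universal_code:
  assumes n: "n > 0"
  shows "\<exists>C\<in>(gud_codes n :: ('a::finite, 'b::finite) gud_code set).
    \<forall>p. \<forall>\<rho>\<in>distortions. \<forall>d>0. rate_redundancy n C p \<rho> d \<le>
      (ln (real (card {t :: 'a multiset. size t = n} * card (distortion_balls n TYPE('a \<times> 'b)))) + ln 2) / n"
proof -
  let ?W = "words n :: 'a list set" and ?Y = "words n :: 'b list set"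
  define Ty where "Ty = {t :: 'a multiset. size t = n}"
  define Bs where "Bs = distortion_balls n TYPE('a \<times> 'b)"
  have fin: "finite Ty" "finite Bs"
    using finite_distortion_balls[OF n] by (auto simp: Ty_def Bs_def finite_multisets_of_size)
  have W: "finite ?W" "finite ?Y"
    by (rule finite_words)+
  have Bs: "ball_quantizers n D \<noteq> {}" if "D \<in> Bs" for D
  proof -
    from that obtain \<rho> :: "'a \<Rightarrow> 'b \<Rightarrow> real" and d
      where "D = distortion_ball n \<rho> d" "\<rho> \<in> distortions" "d > 0"
      by (auto simp: Bs_def distortion_balls_def)
    then show ?thesis
      using quantizers_nonempty[of \<rho> d n] by (simp add: ball_quantizers_distortion_ball)
  qed
  have ball: "distortion_ball n \<rho> d \<in> Bs" if "\<rho> \<in> distortions" "d > 0" for \<rho> d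
    using that by (auto simp: Bs_def distortion_balls_def)
  have type: "mset xs \<in> Ty" if "xs \<in> ?W" for xs
    using that by (auto simp: Ty_def)
  have "\<forall>D t. \<exists>\<phi>. D \<in> Bs \<longrightarrow> \<phi> \<in> ball_quantizers n D \<and>
      (\<forall>\<psi>\<in>ball_quantizers n D. type_cost n \<phi> t \<le> type_cost n \<psi> t)"
    using ex_optimal_quantizer[OF Bs] by blast
  then obtain opt where opt: "\<And>D t. D \<in> Bs \<Longrightarrow> opt D t \<in> ball_quantizers n D"
    "\<And>D t \<psi>. D \<in> Bs \<Longrightarrow> \<psi> \<in> ball_quantizers n D \<Longrightarrow> type_cost n (opt D t) t \<le> type_cost n \<psi> t"
    by metis
  \<comment> \<open>An index is a pair of a type and a ball; \<open>q i\<close> is the output law of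
    the optimal quantizer for that pair on the type class.\<close>
  define q where "q i = cond_output ?W mset (opt (snd i) (fst i)) (fst i)" for i
  define S where "S = {y\<in>?Y. \<exists>i\<in>Ty \<times> Bs. q i y > 0}"
  obtain e where e: "inj_on e S" "prefix_free (e ` S)"
    "\<And>i y. i \<in> Ty \<times> Bs \<Longrightarrow> y \<in> ?Y \<Longrightarrow> q i y > 0 \<Longrightarrow>
      real (length (e y)) * ln 2 \<le> ln (card (Ty \<times> Bs)) + ln 2 - ln (q i y)"
    using mixture_code[of "Ty \<times> Bs" ?Y q] fin W unfolding S_def
    by (auto simp: q_def cond_output_nonneg sum_cond_output_le)
  define C where "C = \<lparr>codebook = S, strings = e ` S,
    quantize = (\<lambda>xs \<rho> d. opt (distortion_ball n \<rho> d) (mset xs) xs),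
    encode = e, decode = inv_into S e\<rparr>"
  have out: "opt D (mset xs) xs \<in> ?Y" if "D \<in> Bs" "xs \<in> ?W" for D xs
    using opt(1)[OF that(1)] that(2) by (auto simp: ball_quantizers_def)
  have qpos: "q (mset xs, D) (opt D (mset xs) xs) > 0" if "xs \<in> ?W" for D xs
    unfolding q_def using cond_output_pos[OF W(1) that] by simp
  have outS: "opt D (mset xs) xs \<in> S" if "D \<in> Bs" "xs \<in> ?W" for D xs
    unfolding S_def using out[OF that] qpos[OF that(2)] type[OF that(2)] that(1) by blast
  have "C \<in> gud_codes n"
    unfolding gud_codes_def
  proof (intro CollectI conjI ballI allI impI)
    show "codebook C \<subseteq> words n"
      by (auto simp: C_def S_def)
    show "encode C \<in> codebook C \<rightarrow> strings C" "prefix_free (encode C ` codebook C)"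
      using e by (auto simp: C_def)
    show "decode C \<in> strings C \<rightarrow> codebook C"
      by (auto simp: C_def e(1))
    show "decode C (encode C ys) = ys" if "ys \<in> codebook C" for ys
      using that e(1) by (simp add: C_def)
    fix xs :: "'a list" and \<rho> :: "'a \<Rightarrow> 'b \<Rightarrow> real" and d :: real
    assume *: "xs \<in> words n" "\<rho> \<in> distortions" "0 < d"
    then show "quantize C xs \<rho> d \<in> codebook C"
      using outS[OF ball] by (simp add: C_def)
    have "opt (distortion_ball n \<rho> d) (mset xs) \<in> quantizers n \<rho> d"
      using opt(1)[OF ball] * by (metis ball_quantizers_distortion_ball)
    then show "distortion_ext n \<rho> xs (quantize C xs \<rho> d) \<le> d"
      using * by (simp add: C_def quantizers_def)
  qed
  moreover have "rate_redundancy n C p \<rho> d \<le> (ln (real (card Ty * card Bs)) + ln 2) / n"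
    if \<rho>: "\<rho> \<in> distortions" and d: "d > 0" for p :: "'a pmf" and \<rho> d
  proof -
    define D where "D = distortion_ball n \<rho> d"
    have D: "D \<in> Bs" "ball_quantizers n D = quantizers n \<rho> d"
      using ball[OF \<rho> d] by (auto simp: D_def ball_quantizers_distortion_ball)
    define r where "r = replicate_pmf n p"
    define L where "L = ln (real (card Ty * card Bs)) + ln 2"
    have r: "set_pmf r \<subseteq> ?W"
      by (auto simp: r_def set_replicate_pmf)
    have sum1: "(\<Sum>x\<in>?W. pmf r x) = 1"
      using W(1) r by (rule sum_pmf_eq_1)
    have const: "pmf r x = pmf r x'" if "x \<in> ?W" "x' \<in> ?W" "mset x = mset x'" for x x'
      using that by (simp add: r_def pmf_replicate_pmf)
    \<comment> \<open>\<open>h t\<close> is the common probability of all words of type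
      \<open>t\<close>; by \<open>const\<close> it does not matter which word \<open>SOME\<close>
      picks.\<close>
    define h where "h t = pmf r (SOME x. x \<in> ?W \<and> mset x = t)" for t
    have h: "pmf r x = h (mset x)" if "x \<in> ?W" for x
    proof -
      have "(SOME x'. x' \<in> ?W \<and> mset x' = mset x) \<in> ?W \<and> mset (SOME x'. x' \<in> ?W \<and> mset x' = mset x) = mset x"
        by (rule someI[of _ x]) (use that in simp)
      then show ?thesis
        unfolding h_def using that by (intro const) auto
    qed
    \<comment> \<open>Here \<open>\<phi>\<close> may vary with the type: the code uses the family
      \<open>opt D\<close>, a competing quantizer the constant family. Both sums get the same
      weights \<open>h\<close>.\<close>
    have group: "(\<Sum>x\<in>?W. pmf r x * - ln (cond_output ?W mset (\<phi> (mset x)) (mset x) (\<phi> (mset x) x)))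
        = (\<Sum>t\<in>mset ` ?W. h t * type_cost n (\<phi> t) t)" for \<phi> :: "'a multiset \<Rightarrow> 'a list \<Rightarrow> 'b list"
      unfolding type_cost_def sum_distrib_left
      by (subst sum.image_gen[OF W(1), of _ mset]) (intro sum.cong; auto simp: h)
    have hnn: "h t \<ge> 0" for t
      by (simp add: h_def)
    have "measure_pmf.expectation r (\<lambda>xs. real (length (encode C (quantize C xs \<rho> d))) * ln 2)
        = (\<Sum>x\<in>?W. pmf r x * (real (length (e (opt D (mset x) x))) * ln 2))"
      using r by (subst integral_measure_pmf[OF W(1)]) (auto simp: C_def D_def)
    also have "\<dots> \<le> (\<Sum>x\<in>?W. pmf r x * (L - ln (q (mset x, D) (opt D (mset x) x))))"
    proof (intro sum_mono mult_left_mono)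
      fix x assume x: "x \<in> ?W"
      show "real (length (e (opt D (mset x) x))) * ln 2 \<le> L - ln (q (mset x, D) (opt D (mset x) x))"
        using e(3)[of "(mset x, D)", OF _ out[OF D(1) x] qpos[OF x]] type[OF x] D(1)
        by (simp add: L_def card_cartesian_product)
    qed simp
    also have "\<dots> = L + (\<Sum>x\<in>?W. pmf r x * - ln (q (mset x, D) (opt D (mset x) x)))"
      by (simp add: algebra_simps sum.distrib sum_subtractf sum_negf sum1 flip: sum_distrib_right sum_distrib_left)
    also have "(\<Sum>x\<in>?W. pmf r x * - ln (q (mset x, D) (opt D (mset x) x)))
        = (\<Sum>t\<in>mset ` ?W. h t * type_cost n (opt D t) t)"
      using group[of "opt D"] by (simp add: q_def)
    finally have E: "measure_pmf.expectation r (\<lambda>xs. real (length (encode C (quantize C xs \<rho> d))) * ln 2)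
        \<le> L + (\<Sum>t\<in>mset ` ?W. h t * type_cost n (opt D t) t)" .
    have "(\<Sum>t\<in>mset ` ?W. h t * type_cost n (opt D t) t) \<le> entropy_nats (output_pmf n p \<phi>)"
      if \<phi>: "\<phi> \<in> quantizers n \<rho> d" for \<phi>
    proof -
      \<comment> \<open>A competitor is compared type by type, since \<open>opt D t\<close> is
        optimal on each class separately. The sum reached is the entropy of the competitor's output
        given the type.\<close>
      have "(\<Sum>t\<in>mset ` ?W. h t * type_cost n (opt D t) t) \<le> (\<Sum>t\<in>mset ` ?W. h t * type_cost n \<phi> t)"
        using opt(2)[OF D(1)] \<phi> D(2) hnn by (intro sum_mono mult_left_mono) auto
      also have "\<dots> = (\<Sum>x\<in>?W. pmf r x * - ln (cond_output ?W mset \<phi> (mset x) (\<phi> x)))"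
        using group[of "\<lambda>_. \<phi>"] by simp
      also have "\<dots> \<le> (\<Sum>x\<in>?W. pmf r x * - ln (\<Sum>x' | x' \<in> ?W \<and> \<phi> x' = \<phi> x. pmf r x'))"
        by (intro conditional_entropy_le W(1) sum1 pmf_nonneg) (rule const)
      also have "\<dots> = entropy_nats (output_pmf n p \<phi>)"
        unfolding output_pmf_def r_def[symmetric] using W(1) r by (rule entropy_nats_map_pmf[symmetric])
      finally show ?thesis .
    qed
    then have "(\<Sum>t\<in>mset ` ?W. h t * type_cost n (opt D t) t) / n
        \<le> (INF \<phi>\<in>quantizers n \<rho> d. entropy_nats (output_pmf n p \<phi>) / n)"
      by (intro cINF_greatest quantizers_nonempty[OF \<rho> d] divide_right_mono of_nat_0_le_iff)
    with divide_right_mono[OF E, of n] show ?thesis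
      by (simp add: rate_redundancy_def r_def L_def add_divide_distrib)
  qed
  ultimately show ?thesis
    unfolding Ty_def Bs_def by blast
qed

text \<open>Absorbing the \<open>+ 1\<close> doubles each of \<open>m\<close> factors, which gives
  the constant \<open>2 ^ m\<close>. Weakening \<open>(m - 1) * m\<close> to
  \<open>m\<^sup>2 - 1\<close> turns the exponent into the constant of the theorem.\<close>

lemma card_types_balls_le:
  fixes n :: nat
  assumes n: "n > 0"
  defines "M \<equiv> card {t :: 'a::finite multiset. size t = n} * card (distortion_balls n TYPE('a \<times> 'b::finite))"
    and "m \<equiv> CARD('a) * CARD('b)"
  shows "M \<le> 2 ^ m * (n + 1) ^ (CARD('a) - 1 + (m\<^sup>2 - 1))"
proof -
  have m: "m > 0"
    by (simp add: m_def)
  have "M \<le> (n + 1) ^ (CARD('a) - 1) * ((n + 1) ^ (m - 1) + 1) ^ m"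
    unfolding M_def m_def by (intro mult_mono card_multisets_of_size_le card_distortion_balls_le n) auto
  also have "\<dots> \<le> (n + 1) ^ (CARD('a) - 1) * (2 * (n + 1) ^ (m - 1)) ^ m"
    by (intro mult_left_mono power_mono) (simp_all add: Suc_leI)
  also have "\<dots> = 2 ^ m * (n + 1) ^ (CARD('a) - 1 + (m - 1) * m)"
    unfolding power_mult_distrib power_add power_mult by simp
  also have "\<dots> \<le> 2 ^ m * (n + 1) ^ (CARD('a) - 1 + (m\<^sup>2 - 1))"
    using m by (intro mult_left_mono power_increasing) (auto simp: power2_eq_square diff_mult_distrib)
  finally show ?thesis .
qed

theorem theorem1:
  shows "limsup (\<lambda>n.
           INF C \<in> (gud_codes n :: ('a::finite, 'b::finite) gud_code set).
             SUP (p, \<rho>, d) \<in> UNIV \<times> distortions \<times> {0<..}.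
               ereal (rate_redundancy n C p \<rho> d / (ln (real n) / real n)))
         \<le> ereal ((real CARD('a))\<^sup>2 * (real CARD('b))\<^sup>2 + real CARD('a) - 2)"
proof -
  define m where "m = CARD('a) * CARD('b)"
  \<comment> \<open>\<open>k\<close> is the claimed limit; \<open>c\<close> collects
    \<open>m * ln 2\<close> from the factor \<open>2 ^ m\<close> in the count and
    \<open>ln 2\<close> from rounding code lengths.\<close>
  define k where "k = real CARD('a) + (real m)\<^sup>2 - 2"
  define c where "c = real (m + 1) * ln 2"
  define u where "u n = k * (ln (real n + 1) / ln (real n)) + c / ln (real n)" for n
  \<comment> \<open>From \<open>n = 2\<close> on, \<open>ln n\<close> is positive, so normalizing by
    it preserves inequalities.\<close>
  have bound: "(INF C \<in> (gud_codes n :: ('a, 'b) gud_code set).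
      SUP (p, \<rho>, d) \<in> UNIV \<times> distortions \<times> {0<..}.
        ereal (rate_redundancy n C p \<rho> d / (ln (real n) / real n))) \<le> ereal (u n)"
    if n: "n \<ge> 2" for n
  proof -
    define M where "M = card {t :: 'a multiset. size t = n} * card (distortion_balls n TYPE('a \<times> 'b))"
    obtain C where C: "C \<in> (gud_codes n :: ('a, 'b) gud_code set)"
      and red: "\<And>p \<rho> d. \<rho> \<in> distortions \<Longrightarrow> d > 0 \<Longrightarrow> rate_redundancy n C p \<rho> d \<le> (ln (real M) + ln 2) / n"
      using ex_universal_code[of n, where 'a='a and 'b='b] n unfolding M_def by fastforce
    have le: "real M \<le> real (2 ^ m * (n + 1) ^ (CARD('a) - 1 + (m\<^sup>2 - 1)))"
      using card_types_balls_le[of n, where 'a='a and 'b='b] n unfolding M_def m_def of_nat_le_iff by simp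
    have k: "real (CARD('a) - 1 + (m\<^sup>2 - 1)) = k"
    proof -
      have "CARD('a) \<ge> 1" "m\<^sup>2 \<ge> 1"
        by (simp_all add: m_def Suc_leI)
      then show ?thesis
        by (simp only: k_def of_nat_add of_nat_diff of_nat_power)
    qed
    have "ln (real M) \<le> m * ln 2 + k * ln (real n + 1)"
    \<comment> \<open>For \<open>M = 0\<close> the left side is 0 because \<open>ln 0 = 0\<close>,
      and \<open>k\<close> is nonnegative, being the value of a natural number.\<close>
    proof (cases "M = 0")
      case False
      then have "ln (real M) \<le> ln (2 ^ m * (real n + 1) ^ (CARD('a) - 1 + (m\<^sup>2 - 1)))"
        using le by (simp add: add.commute)
      also have "\<dots> = m * ln 2 + real (CARD('a) - 1 + (m\<^sup>2 - 1)) * ln (real n + 1)"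
        by (simp only: ln_mult_pos ln_realpow zero_less_power zero_less_numeral
            of_nat_0_le_iff add_nonneg_pos zero_less_one)
      finally show ?thesis
        by (simp only: k)
    next
      case True
      then show ?thesis
        using n by (simp flip: k)
    qed
    then have M: "ln (real M) + ln 2 \<le> k * ln (real n + 1) + c"
      by (simp add: c_def algebra_simps)
    have "rate_redundancy n C p \<rho> d / (ln (real n) / real n) \<le> u n"
      if "\<rho> \<in> distortions" "d > 0" for p \<rho> d
    proof -
      have "rate_redundancy n C p \<rho> d / (ln (real n) / real n)
          \<le> ((k * ln (real n + 1) + c) / n) / (ln (real n) / real n)"
        using order_trans[OF red[OF that, of p] divide_right_mono[OF M of_nat_0_le_iff]] n
        by (intro divide_right_mono) auto
      also have "\<dots> = u n"
        using n by (simp add: u_def divide_simps)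
      finally show ?thesis .
    qed
    then have "(SUP (p, \<rho>, d) \<in> UNIV \<times> distortions \<times> {0<..}.
        ereal (rate_redundancy n C p \<rho> d / (ln (real n) / real n))) \<le> ereal (u n)"
      by (auto intro!: SUP_least)
    with C show ?thesis
      by (rule INF_lower2)
  qed
  have "(\<lambda>n. ln (real n + 1) / ln (real n)) \<longlonglongrightarrow> 1" "(\<lambda>n. c / ln (real n)) \<longlonglongrightarrow> 0"
    by real_asymp+
  then have "u \<longlonglongrightarrow> k * 1 + 0"
    unfolding u_def by (intro tendsto_intros)
  then have "limsup (\<lambda>n. ereal (u n)) = ereal k"
    by (intro lim_imp_Limsup) simp_all
  moreover have "limsup (\<lambda>n. INF C \<in> (gud_codes n :: ('a, 'b) gud_code set).
      SUP (p, \<rho>, d) \<in> UNIV \<times> distortions \<times> {0<..}.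
        ereal (rate_redundancy n C p \<rho> d / (ln (real n) / real n))) \<le> limsup (\<lambda>n. ereal (u n))"
    by (intro Limsup_mono eventually_sequentiallyI[of 2] bound)
  ultimately show ?thesis
    by (simp add: k_def m_def power_mult_distrib add.commute)
qed

end
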